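(* Let $\mathcal{Z}$ be a measurable space, $P$ a probability distribution on $\mathcal{Z}\times\mathcal{Z}$, $\mu$ a $\sigma$-finite base measure on $\mathcal{Z}$, and $Q$ an ensembling channel on $\mathcal{Z}$ such that $Q(\cdot\mid z)$ has a density with respect to $\mu$ for every $z\in\mathcal{Z}$. Let $\mathcal{H}$ be a separable (real) Hilbert space. Then \[\|T_{P,Q}\|_{L_\infty(\mathcal{H})\to L_1(\mathcal{H})}\leq C_{\mathrm{G}}\,\|T_{P,Q}\|_{L_\infty\to L_1},\] where $C_{\mathrm{G}}$ denotes Grothendieck's constant.
   Context: An ensembling channel $Q$ is a Markov kernel on $\mathcal{Z}$: for each $z\in\mathcal{Z}$, $Q(\cdot\mid z)$ is a probability distribution on $\mathcal{Z}$. Its density with respect to $\mu$ is also denoted $Q(\cdot\mid z)$, and the map $(w,z)\mapsto Q(w\mid z)$ is taken jointly measurable. The kernel is \[K_{P,Q}(z,z')=\mathbb{E}_{(Z_0,Z_1)\sim P}\big[(Q(z\mid Z_0)-Q(z\mid Z_1))\,(Q(z'\mid Z_0)-Q(z'\mid Z_1))\big].\] For bounded measurable $f:\mathcal{Z}\to\mathbb{R}$ or $f:\mathcal{Z}\to\mathcal{H}$, $[T_{P,Q}f](z)=\int_{\mathcal{Z}}K_{P,Q}(z,z')f(z')\,d\mu(z')$. Real-valued norm: $\|T_{P,Q}\|_{L_\infty\to L_1}=\sup\{\|T_{P,Q}f\|_{L_1}: f:\mathcal{Z}\to\mathbb{R}\text{ measurable},\ \|f\|_{L_\infty}\leq1\}$,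 with $\|f\|_{L_1}=\int_{\mathcal{Z}}|f|\,d\mu$ and $\|f\|_{L_\infty}=\sup_{z\in\mathcal{Z}}|f(z)|$. Hilbert-valued norm: $\|T_{P,Q}\|_{L_\infty(\mathcal{H})\to L_1(\mathcal{H})}=\sup\{\|T_{P,Q}f\|_{L_1(\mathcal{H})}: f:\mathcal{Z}\to\mathcal{H}\text{ measurable},\ \|f\|_{L_\infty(\mathcal{H})}\leq1\}$, with $\|f\|_{L_1(\mathcal{H})}=\int_{\mathcal{Z}}\|f(z)\|_{\mathcal{H}}\,d\mu(z)$ and $\|f\|_{L_\infty(\mathcal{H})}=\sup_{z\in\mathcal{Z}}\|f(z)\|_{\mathcal{H}}$. Grothendieck's constant $C_{\mathrm{G}}$ is the (real) one: the smallest constant $C$ such that for every $n\geq1$, every real matrix $(a_{ij})\in\mathbb{R}^{n\times n}$, every real Hilbert space and all vectors $u_j,v_i$ in its closed unit ball, $\big|\sum_{i,j}a_{ij}\langle u_j,v_i\rangle\big|\leq C\,\sup\big\{\big|\sum_{i,j}a_{ij}s_jt_i\big|: s,t\in[-1,1]^n\big\}$. It is known that $1.67<C_{\mathrm{G}}<1.79$. *)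

theory Defs
  imports "HOL-Probability.Probability"
begin

locale real_hilbert_space =
  fixes V :: "'v set"
    and add :: "'v \<Rightarrow> 'v \<Rightarrow> 'v"
    and zero :: 'v
    and scale :: "real \<Rightarrow> 'v \<Rightarrow> 'v"
    and ip :: "'v \<Rightarrow> 'v \<Rightarrow> real"
  assumes add_closed: "\<lbrakk>x \<in> V; y \<in> V\<rbrakk> \<Longrightarrow> add x y \<in> V"
    and zero_closed: "zero \<in> V"
    and scale_closed: "x \<in> V \<Longrightarrow> scale r x \<in> V"
    and add_assoc: "\<lbrakk>x \<in> V; y \<in> V; z \<in> V\<rbrakk> \<Longrightarrow> add (add x y) z = add x (add y z)"
    and add_commute: "\<lbrakk>x \<in> V; y \<in> V\<rbrakk> \<Longrightarrow> add x y = add y x"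
    and add_zero: "x \<in> V \<Longrightarrow> add x zero = x"
    and add_inverse: "x \<in> V \<Longrightarrow> add x (scale (-1) x) = zero"
    and scale_add: "\<lbrakk>x \<in> V; y \<in> V\<rbrakk> \<Longrightarrow> scale r (add x y) = add (scale r x) (scale r y)"
    and add_scale: "x \<in> V \<Longrightarrow> scale (r + s) x = add (scale r x) (scale s x)"
    and scale_scale: "x \<in> V \<Longrightarrow> scale r (scale s x) = scale (r * s) x"
    and scale_one: "x \<in> V \<Longrightarrow> scale 1 x = x"
    and ip_commute: "\<lbrakk>x \<in> V; y \<in> V\<rbrakk> \<Longrightarrow> ip x y = ip y x"
    and ip_add: "\<lbrakk>x \<in> V; y \<in> V; z \<in> V\<rbrakk> \<Longrightarrow> ip (add x y) z = ip x z + ip y z"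
    and ip_scale: "\<lbrakk>x \<in> V; y \<in> V\<rbrakk> \<Longrightarrow> ip (scale r x) y = r * ip x y"
    and ip_nonneg: "x \<in> V \<Longrightarrow> 0 \<le> ip x x"
    and ip_definite: "\<lbrakk>x \<in> V; ip x x = 0\<rbrakk> \<Longrightarrow> x = zero"
    and complete:
      "\<lbrakk>\<And>n::nat. X n \<in> V;
        \<And>e. 0 < e \<Longrightarrow> \<exists>N. \<forall>m\<ge>N. \<forall>n\<ge>N.
           sqrt (ip (add (X m) (scale (-1) (X n))) (add (X m) (scale (-1) (X n)))) < e\<rbrakk>
       \<Longrightarrow> \<exists>l\<in>V. (\<lambda>n. sqrt (ip (add (X n) (scale (-1) l)) (add (X n) (scale (-1) l)))) \<longlonglongrightarrow> 0"

lemma real_hilbert_space_UNIV: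
  "real_hilbert_space (UNIV :: 'h::{real_inner, complete_space} set) (+) 0 (*\<^sub>R) (\<bullet>)"
proof
  fix X :: "nat \<Rightarrow> 'h"
  assume *: "\<And>e. 0 < e \<Longrightarrow> \<exists>N. \<forall>m\<ge>N. \<forall>n\<ge>N.
      sqrt ((X m + (-1) *\<^sub>R X n) \<bullet> (X m + (-1) *\<^sub>R X n)) < e"
  have "Cauchy X"
    unfolding Cauchy_def dist_norm norm_eq_sqrt_inner using * by simp
  then obtain l where "X \<longlonglongrightarrow> l"
    using Cauchy_convergent_iff convergent_def by blast
  then have "(\<lambda>n. norm (X n - l)) \<longlonglongrightarrow> 0"
    by (intro tendsto_norm_zero LIM_zero)
  then show "\<exists>l\<in>UNIV. (\<lambda>n. sqrt ((X n + (-1) *\<^sub>R l) \<bullet> (X n + (-1) *\<^sub>R l))) \<longlonglongrightarrow> 0"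
    unfolding norm_eq_sqrt_inner by auto
qed (auto simp: scaleR_add_left scaleR_add_right inner_add_left add.assoc intro: inner_commute add.commute)

text \<open>
  A constant cannot quantify over all types, so the Hilbert spaces range over all structures whose
  carrier is a set of real sequences; up to isometry these are all real Hilbert spaces of at most
  continuum cardinality. Nothing is lost, as only finitely many vectors occur for each \<open>n\<close>: the
  lemma \<open>grothendieck_bound_inner\<close> below recovers the inequality in every real inner product space.
\<close>

definition grothendieck_bound :: "real \<Rightarrow> bool" where
  "grothendieck_bound C \<longleftrightarrow>
    (\<forall>n\<ge>1. \<forall>a :: nat \<Rightarrow> nat \<Rightarrow> real.
     \<forall>(V :: (nat \<Rightarrow> real) set) add zero scale ip. real_hilbert_space V add zero scale ip \<longrightarrow>
     (\<forall>u v. (\<forall>i<n. u i \<in> V \<and> sqrt (ip (u i) (u i)) \<le> 1) \<and>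
            (\<forall>i<n. v i \<in> V \<and> sqrt (ip (v i) (v i)) \<le> 1) \<longrightarrow>
       \<bar>\<Sum>i<n. \<Sum>j<n. a i j * ip (u j) (v i)\<bar>
       \<le> C * Sup {\<bar>\<Sum>i<n. \<Sum>j<n. a i j * s j * t i\<bar> | s t.
                    (\<forall>i<n. s i \<in> {-1..1}) \<and> (\<forall>i<n. t i \<in> {-1..1})}))"

text \<open>
  The set of admissible constants is closed and contains only reals \<open>\<ge> 1\<close>, so the infimum is its least
  element. Taking it in \<^typ>\<open>ennreal\<close> makes the definition meaningful without first showing that the
  set is nonempty, which is Grothendieck's inequality.
\<close>

definition grothendieck_constant :: ennreal where
  "grothendieck_constant = (INF C \<in> {C. grothendieck_bound C}. ennreal C)"

lemma orthonormal_span_exists: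
  fixes S :: "'h::real_inner set"
  assumes "finite S"
  shows "\<exists>B. finite B \<and> (\<forall>b\<in>B. \<forall>c\<in>B. b \<bullet> c = (if b = c then 1 else 0)) \<and>
             (\<forall>x\<in>S. x = (\<Sum>b\<in>B. (x \<bullet> b) *\<^sub>R b))"
  using assms
proof (induction S rule: finite_induct)
  case empty
  show ?case by (intro exI[of _ "{}"]) auto
next
  case (insert x S)
  then obtain B where B: "finite B" "\<forall>b\<in>B. \<forall>c\<in>B. b \<bullet> c = (if b = c then 1 else 0)"
    and S: "\<forall>x\<in>S. x = (\<Sum>b\<in>B. (x \<bullet> b) *\<^sub>R b)"
    by blast
  define r where "r = x - (\<Sum>b\<in>B. (x \<bullet> b) *\<^sub>R b)"
  have orth: "r \<bullet> c = 0" if "c \<in> B" for c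
  proof -
    have "(\<Sum>b\<in>B. (x \<bullet> b) *\<^sub>R b) \<bullet> c = (\<Sum>b\<in>B. if b = c then x \<bullet> b else 0)"
      unfolding inner_sum_left using B(2) that by (intro sum.cong) auto
    then show ?thesis
      using B(1) that by (simp add: r_def inner_diff_left)
  qed
  show ?case
  proof (cases "r = 0")
    case True
    then show ?thesis
      using B S by (intro exI[of _ B]) (simp add: r_def)
  next
    case False
    define e where "e = r /\<^sub>R norm r"
    have ee: "e \<bullet> e = 1"
      using False by (simp add: e_def dot_square_norm power2_eq_square)
    have eB: "e \<bullet> c = 0" "c \<bullet> e = 0" if "c \<in> B" for c
      using orth[OF that] by (auto simp: e_def inner_commute)
    have "e \<notin> B"
      using ee eB(1) by fastforce
    have xe: "(x \<bullet> e) *\<^sub>R e = r"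
    proof -
      have "x \<bullet> e = r \<bullet> e"
        using eB by (simp add: r_def inner_diff_left inner_sum_left)
      also have "\<dots> = norm r"
        using False by (simp add: e_def dot_square_norm power2_eq_square)
      finally show ?thesis
        using False by (simp add: e_def)
    qed
    have Se: "y \<bullet> e = 0" if "y \<in> S" for y
    proof -
      have "y \<bullet> e = (\<Sum>b\<in>B. (y \<bullet> b) *\<^sub>R b) \<bullet> e"
        using S that by metis
      then show ?thesis
        using eB by (simp add: inner_sum_left)
    qed
    show ?thesis
    proof (intro exI[of _ "insert e B"] conjI ballI)
      fix y assume "y \<in> insert x S"
      then show "y = (\<Sum>b\<in>insert e B. (y \<bullet> b) *\<^sub>R b)"
        using S Se xe B(1) \<open>e \<notin> B\<close> by (auto simp: r_def)
    qed (use B ee eB \<open>e \<notin> B\<close> in auto)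
  qed
qed

lemma real_hilbert_space_coordinates:
  "real_hilbert_space {x :: nat \<Rightarrow> real. \<forall>k\<ge>d. x k = 0} (\<lambda>x y k. x k + y k) (\<lambda>_. 0)
     (\<lambda>r x k. r * x k) (\<lambda>x y. \<Sum>k<d. x k * y k)"
proof (unfold_locales, goal_cases)
  case (16 x)
  then have "\<forall>k<d. x k * x k = 0"
    by (subst (asm) sum_nonneg_eq_0_iff) auto
  then show ?case
    using 16 by (auto simp: fun_eq_iff) (metis not_le)
next
  case (17 X)
  have "\<exists>l. (\<lambda>n. X n k) \<longlonglongrightarrow> l" if "k < d" for k
  proof -
    have "Cauchy (\<lambda>n. X n k)"
      unfolding Cauchy_def
    proof (intro allI impI)
      fix e :: real assume "0 < e"
      then obtain N where N: "\<And>m n. m \<ge> N \<Longrightarrow> n \<ge> N \<Longrightarrow>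
          sqrt (\<Sum>k<d. (X m k + -1 * X n k) * (X m k + -1 * X n k)) < e"
        using 17(2) by meson
      have "dist (X m k) (X n k) < e" if "m \<ge> N" "n \<ge> N" for m n
      proof -
        have "(X m k - X n k)\<^sup>2 \<le> (\<Sum>k<d. (X m k + -1 * X n k) * (X m k + -1 * X n k))"
          using \<open>k < d\<close>
          by (intro order.trans[OF _ member_le_sum[of k]]) (auto simp: power2_eq_square)
        then have "\<bar>X m k - X n k\<bar> \<le> sqrt (\<Sum>k<d. (X m k + -1 * X n k) * (X m k + -1 * X n k))"
          using real_le_rsqrt real_sqrt_abs real_sqrt_le_iff by metis
        with N[OF that] show ?thesis
          by (simp add: dist_real_def)
      qed
      then show "\<exists>M. \<forall>m\<ge>M. \<forall>n\<ge>M. dist (X m k) (X n k) < e" by blast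
    qed
    then show ?thesis
      using Cauchy_convergent_iff convergent_def by blast
  qed
  then obtain L where L: "\<And>k. k < d \<Longrightarrow> (\<lambda>n. X n k) \<longlonglongrightarrow> L k" by metis
  define l where "l = (\<lambda>k. if k < d then L k else 0)"
  have "(\<lambda>n. sqrt (\<Sum>k<d. (X n k + -1 * l k) * (X n k + -1 * l k)))
      \<longlonglongrightarrow> sqrt (\<Sum>k<d. (l k + -1 * l k) * (l k + -1 * l k))"
    by (intro tendsto_intros) (auto simp: l_def L)
  then show ?case
    by (intro bexI[of _ l]) (auto simp: l_def)
qed (auto simp: algebra_simps sum.distrib sum_distrib_left sum_nonneg)

lemma grothendieck_bound_inner:
  fixes u v :: "nat \<Rightarrow> 'h::real_inner"
  assumes "grothendieck_bound C" "n \<ge> 1"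
    and "\<And>i. i < n \<Longrightarrow> norm (u i) \<le> 1" "\<And>i. i < n \<Longrightarrow> norm (v i) \<le> 1"
  shows "\<bar>\<Sum>i<n. \<Sum>j<n. a i j * (u j \<bullet> v i)\<bar>
    \<le> C * Sup {\<bar>\<Sum>i<n. \<Sum>j<n. a i j * s j * t i\<bar> | s t.
                 (\<forall>i<n. s i \<in> {-1..1}) \<and> (\<forall>i<n. t i \<in> {-1..1})}"
proof -
  have "finite (u ` {..<n} \<union> v ` {..<n})" by simp
  from orthonormal_span_exists[OF this]
  obtain B where B: "finite B" "\<forall>b\<in>B. \<forall>c\<in>B. b \<bullet> c = (if b = c then 1 else 0)"
    and S: "\<forall>x\<in>u ` {..<n} \<union> v ` {..<n}. x = (\<Sum>b\<in>B. (x \<bullet> b) *\<^sub>R b)"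
    by blast
  obtain h where h: "bij_betw h {..<card B} B"
    using ex_bij_betw_nat_finite[OF B(1)] by (auto simp: atLeast0LessThan)
  define \<phi> where "\<phi> x = (\<lambda>k. if k < card B then x \<bullet> h k else 0)" for x :: 'h
  let ?ip = "\<lambda>x y :: nat \<Rightarrow> real. \<Sum>k<card B. x k * y k"
  have ip: "?ip (\<phi> x) (\<phi> y) = x \<bullet> y" if "x \<in> u ` {..<n} \<union> v ` {..<n}" for x y
  proof -
    have "?ip (\<phi> x) (\<phi> y) = (\<Sum>k<card B. (x \<bullet> h k) * (y \<bullet> h k))"
      by (simp add: \<phi>_def)
    also have "\<dots> = (\<Sum>b\<in>B. (x \<bullet> b) * (y \<bullet> b))"
      using sum.reindex_bij_betw[OF h] by fast
    also have "\<dots> = (\<Sum>b\<in>B. (x \<bullet> b) *\<^sub>R b) \<bullet> y"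
      by (simp add: inner_sum_left inner_commute[of y])
    also have "\<dots> = x \<bullet> y"
      using S that by metis
    finally show ?thesis .
  qed
  have "\<bar>\<Sum>i<n. \<Sum>j<n. a i j * ?ip (\<phi> (u j)) (\<phi> (v i))\<bar>
    \<le> C * Sup {\<bar>\<Sum>i<n. \<Sum>j<n. a i j * s j * t i\<bar> | s t.
                 (\<forall>i<n. s i \<in> {-1..1}) \<and> (\<forall>i<n. t i \<in> {-1..1})}"
  proof (rule assms(1)[unfolded grothendieck_bound_def, rule_format,
        OF assms(2) real_hilbert_space_coordinates[of "card B"]], intro conjI allI impI)
    fix i assume "i < n"
    then show "sqrt (?ip (\<phi> (u i)) (\<phi> (u i))) \<le> 1" "sqrt (?ip (\<phi> (v i)) (\<phi> (v i))) \<le> 1"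
      using assms(3,4) by (simp_all add: ip flip: norm_eq_sqrt_inner)
  qed (auto simp: \<phi>_def)
  then show ?thesis
    by (simp add: ip)
qed

text \<open>
  The density \<open>q w z\<close> is \<open>Q(w | z)\<close>. Because densities may be unbounded, the expectation in the
  kernel can fail to exist on a null set of \<open>(z, z')\<close>, and likewise the integral in the operator on
  a null set of \<open>z\<close>; the Bochner integral is 0 there, which affects no \<open>L1\<close> norm.
\<close>

definition ensembling_kernel ::
  "('a \<times> 'a) measure \<Rightarrow> ('a \<Rightarrow> 'a \<Rightarrow> real) \<Rightarrow> 'a \<Rightarrow> 'a \<Rightarrow> real" where
  "ensembling_kernel P q z z' =
    (\<integral>(z0, z1). (q z z0 - q z z1) * (q z' z0 - q z' z1) \<partial>P)"

definition ensembling_operator ::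
  "'a measure \<Rightarrow> ('a \<times> 'a) measure \<Rightarrow> ('a \<Rightarrow> 'a \<Rightarrow> real) \<Rightarrow>
   ('a \<Rightarrow> 'b::{banach, second_countable_topology}) \<Rightarrow> 'a \<Rightarrow> 'b" where
  "ensembling_operator \<mu> P q f z = (\<integral>z'. ensembling_kernel P q z z' *\<^sub>R f z' \<partial>\<mu>)"

definition L1_norm :: "'a measure \<Rightarrow> ('a \<Rightarrow> 'b::real_normed_vector) \<Rightarrow> ennreal" where
  "L1_norm \<mu> f = (\<integral>\<^sup>+z. ennreal (norm (f z)) \<partial>\<mu>)"

text \<open>A pointwise supremum, not an essential one.\<close>

definition Linf_norm :: "'a measure \<Rightarrow> ('a \<Rightarrow> 'b::real_normed_vector) \<Rightarrow> ennreal" where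
  "Linf_norm \<mu> f = (SUP z\<in>space \<mu>. ennreal (norm (f z)))"

definition Linf_L1_opnorm ::
  "'a measure \<Rightarrow> (('a \<Rightarrow> 'b::real_normed_vector) \<Rightarrow> 'a \<Rightarrow> 'b) \<Rightarrow> ennreal" where
  "Linf_L1_opnorm \<mu> T =
    (SUP f \<in> {f. f \<in> borel_measurable \<mu> \<and> Linf_norm \<mu> f \<le> 1}. L1_norm \<mu> (T f))"

end

theory Submission
  imports Defs
begin

text \<open>
  The kernel \<open>K\<close> is integrable over \<open>\<mu> \<Otimes> \<mu>\<close>, because each \<open>Q(\<cdot> | z)\<close> has mass one
  (\<open>integrable_ensembling_kernel\<close>). The rest uses only this integrability. With
  \<open>g = sgn (T f)\<close>, Fubini turns the \<open>L1\<close> norm of \<open>T f\<close> into the bilinear expression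
  \<open>\<integral>\<integral> K(z, z') \<langle>f(z'), g(z)\<rangle>\<close> (\<open>integral_norm_kernel_operator\<close>). If \<open>f\<close> and \<open>g\<close> take finitely
  many values, this is \<open>\<Sum>\<^sub>x \<Sum>\<^sub>y a x y \<langle>u y, v x\<rangle>\<close>, where \<open>a x y\<close> is the integral of \<open>K\<close> over a
  rectangle of cells of a common finite partition (\<open>integral_simple_pairing\<close>), and Grothendieck's
  inequality applies to it. The scalar forms \<open>\<Sum>\<^sub>x \<Sum>\<^sub>y a x y s(y) t(x)\<close> on the other side of that
  inequality are pairings of \<open>T s\<close> with \<open>t\<close> for real step functions \<open>s\<close> and \<open>t\<close>, so that they are
  bounded by the real operator norm. General \<open>f\<close> and \<open>g\<close> in the unit ball are pointwise limits of
  simple functions in the unit ball, and dominated convergence carries the bound over.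

  Multiplication in \<^typ>\<open>ennreal\<close> satisfies \<open>\<infinity> * 0 = 0\<close>. Hence a real operator norm of zero is
  treated separately, without using that Grothendieck's constant is finite: all the scalar forms,
  and with them the matrices \<open>a\<close>, then vanish.
\<close>

section \<open>Grothendieck's inequality over a finite index set\<close>

lemma grothendieck_bound_nonneg:
  assumes "grothendieck_bound C"
  shows "0 \<le> C"
proof (rule ccontr)
  let ?S = "{\<bar>\<Sum>i<1. \<Sum>j<1. (\<lambda>_ _. 1) i j * s j * t i\<bar> | s t :: nat \<Rightarrow> real.
              (\<forall>i<1::nat. s i \<in> {-1..1}) \<and> (\<forall>i<1. t i \<in> {-1..1})}"
  assume "\<not> 0 \<le> C"
  have "0 \<in> ?S"
    by (auto intro!: exI[of _ "\<lambda>_. 0"])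
  moreover have "bdd_above ?S"
  proof (rule bdd_aboveI)
    fix x assume "x \<in> ?S"
    then obtain s t :: "nat \<Rightarrow> real" where st: "x = \<bar>s 0\<bar> * \<bar>t 0\<bar>" "\<bar>s 0\<bar> \<le> 1" "\<bar>t 0\<bar> \<le> 1"
      by (auto simp: abs_mult abs_le_iff)
    then show "x \<le> 1"
      by (simp add: mult_le_one)
  qed
  ultimately have "0 \<le> Sup ?S"
    by (rule cSup_upper)
  with \<open>\<not> 0 \<le> C\<close> have "C * Sup ?S \<le> 0"
    by (simp add: mult_nonpos_nonneg)
  moreover have "\<bar>\<Sum>i<1::nat. \<Sum>j<1::nat. (\<lambda>_ _. 1) i j * ((\<lambda>_. 1::real) j \<bullet> (\<lambda>_. 1) i)\<bar> \<le> C * Sup ?S"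
    by (rule grothendieck_bound_inner[OF assms, of 1 "\<lambda>_. 1" "\<lambda>_. 1" "\<lambda>_ _. 1"]) auto
  ultimately show False
    by simp
qed

lemma grothendieck_bound_finite_set:
  fixes u v :: "'b \<Rightarrow> 'h::real_inner"
  assumes C: "grothendieck_bound C" and "finite R"
    and u: "\<And>x. x \<in> R \<Longrightarrow> norm (u x) \<le> 1" and v: "\<And>x. x \<in> R \<Longrightarrow> norm (v x) \<le> 1"
    and M: "\<And>s t :: 'b \<Rightarrow> real. (\<And>x. x \<in> R \<Longrightarrow> \<bar>s x\<bar> \<le> 1) \<Longrightarrow> (\<And>x. x \<in> R \<Longrightarrow> \<bar>t x\<bar> \<le> 1) \<Longrightarrow>
      \<bar>\<Sum>x\<in>R. \<Sum>y\<in>R. a x y * (s y * t x)\<bar> \<le> M"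
  shows "\<bar>\<Sum>x\<in>R. \<Sum>y\<in>R. a x y * (u y \<bullet> v x)\<bar> \<le> C * M"
proof (cases "R = {}")
  case True
  have "0 \<le> M"
    using M[of "\<lambda>_. 0" "\<lambda>_. 0"] by simp
  with grothendieck_bound_nonneg[OF C] True show ?thesis
    by simp
next
  case False
  define n where "n = card R"
  have "n \<ge> 1"
    using False \<open>finite R\<close> by (simp add: n_def Suc_le_eq card_gt_0_iff)
  obtain e where e: "bij_betw e {..<n} R"
    using ex_bij_betw_nat_finite[OF \<open>finite R\<close>] by (auto simp: atLeast0LessThan n_def)
  have eR: "e i \<in> R" if "i < n" for i
    using e that by (auto simp: bij_betw_def)
  have reindex: "(\<Sum>x\<in>R. \<Sum>y\<in>R. \<phi> x y) = (\<Sum>i<n. \<Sum>j<n. \<phi> (e i) (e j))" for \<phi> :: "'b \<Rightarrow> 'b \<Rightarrow> real"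
    by (simp add: sum.reindex_bij_betw[OF e, symmetric])
  let ?S = "{\<bar>\<Sum>i<n. \<Sum>j<n. a (e i) (e j) * s j * t i\<bar> | s t.
              (\<forall>i<n. s i \<in> {-1..1}) \<and> (\<forall>i<n. t i \<in> {-1..1})}"
  have "\<bar>\<Sum>x\<in>R. \<Sum>y\<in>R. a x y * (u y \<bullet> v x)\<bar>
      = \<bar>\<Sum>i<n. \<Sum>j<n. a (e i) (e j) * (u (e j) \<bullet> v (e i))\<bar>"
    by (simp add: reindex)
  also have "\<dots> \<le> C * Sup ?S"
    using grothendieck_bound_inner[OF C \<open>n \<ge> 1\<close>, of "u \<circ> e" "v \<circ> e" "\<lambda>i j. a (e i) (e j)"] u v eR
    by simp
  also have "\<dots> \<le> C * M"
  proof (rule mult_left_mono[OF _ grothendieck_bound_nonneg[OF C]], rule cSup_least)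
    show "?S \<noteq> {}"
      by (auto intro!: exI[of _ "\<lambda>_. 0"])
    fix r assume "r \<in> ?S"
    then obtain s t where r: "r = \<bar>\<Sum>i<n. \<Sum>j<n. a (e i) (e j) * s j * t i\<bar>"
      and st: "\<forall>i<n. s i \<in> {-1..1}" "\<forall>i<n. t i \<in> {-1..1}"
      by blast
    define e' where "e' = the_inv_into {..<n} e"
    have e': "e' (e i) = i" if "i < n" for i
      using e that by (auto simp: e'_def bij_betw_def intro!: the_inv_into_f_f)
    have "e' x < n" if "x \<in> R" for x
      using e e' that by (auto simp: bij_betw_def)
    then have "\<bar>\<Sum>x\<in>R. \<Sum>y\<in>R. a x y * (s (e' y) * t (e' x))\<bar> \<le> M"
      using st by (intro M) (auto simp: abs_le_iff)
    then show "r \<le> M"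
      by (simp add: reindex r e' mult.assoc)
  qed
  finally show ?thesis .
qed

text \<open>A matrix whose bilinear form is zero on the unit cube is itself zero; no constant is needed.\<close>

lemma zero_bilinear_form_finite_set:
  fixes a :: "'b \<Rightarrow> 'b \<Rightarrow> real"
  assumes "finite R"
    and M: "\<And>s t :: 'b \<Rightarrow> real. (\<And>x. x \<in> R \<Longrightarrow> \<bar>s x\<bar> \<le> 1) \<Longrightarrow> (\<And>x. x \<in> R \<Longrightarrow> \<bar>t x\<bar> \<le> 1) \<Longrightarrow>
      \<bar>\<Sum>x\<in>R. \<Sum>y\<in>R. a x y * (s y * t x)\<bar> \<le> 0"
    and "x \<in> R" "y \<in> R"
  shows "a x y = 0"
proof -
  have "\<bar>\<Sum>x'\<in>R. \<Sum>y'\<in>R. a x' y' * (indicator {y} y' * indicator {x} x')\<bar> \<le> 0"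
    by (rule M) (auto simp: indicator_def)
  also have "(\<Sum>x'\<in>R. \<Sum>y'\<in>R. a x' y' * (indicator {y} y' * indicator {x} x'))
      = (\<Sum>x'\<in>R. \<Sum>y'\<in>R. if y' = y then if x' = x then a x y else 0 else 0)"
    by (intro sum.cong refl) (auto simp: indicator_def)
  also have "\<dots> = a x y"
    using assms by (simp add: sum.delta)
  finally show ?thesis
    by simp
qed

section \<open>Integral operators with integrable kernel\<close>

text \<open>
  As a Bochner integral, this is 0 at points \<open>z\<close> where the integrand is not integrable. For an
  integrable kernel and bounded measurable \<open>f\<close> such \<open>z\<close> form a null set.
\<close>

definition kernel_operator ::
  "'a measure \<Rightarrow> ('a \<Rightarrow> 'a \<Rightarrow> real) \<Rightarrow> ('a \<Rightarrow> 'b::{banach, second_countable_topology}) \<Rightarrow> 'a \<Rightarrow> 'b" where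
  "kernel_operator M K f z = (\<integral>z'. K z z' *\<^sub>R f z' \<partial>M)"

lemma Linf_norm_le_1_iff: "Linf_norm M f \<le> 1 \<longleftrightarrow> (\<forall>z\<in>space M. norm (f z) \<le> 1)"
  by (simp add: Linf_norm_def SUP_le_iff)

text \<open>
  Pointwise approximation by simple functions in general only keeps the norm of the approximants
  below twice that of \<open>f\<close>; composing them with the radial projection \<open>p\<close> onto the unit ball keeps
  them in the ball.
\<close>

lemma simple_approximation_unit_ball:
  fixes f :: "'a \<Rightarrow> 'b::{real_normed_vector, second_countable_topology}"
  assumes "f \<in> borel_measurable M" and f: "\<And>x. x \<in> space M \<Longrightarrow> norm (f x) \<le> 1"
  obtains F where "\<And>i::nat. simple_function M (F i)" "\<And>i x. norm (F i x) \<le> 1"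
    "\<And>x. x \<in> space M \<Longrightarrow> (\<lambda>i. F i x) \<longlonglongrightarrow> f x"
proof -
  obtain F where F: "\<And>i::nat. simple_function M (F i)"
    "\<And>x. x \<in> space M \<Longrightarrow> (\<lambda>i. F i x) \<longlonglongrightarrow> f x"
    using borel_measurable_implies_sequence_metric[OF assms(1), of 0] by blast
  define p where "p y = y /\<^sub>R max 1 (norm y)" for y :: 'b
  show thesis
  proof
    show "simple_function M (\<lambda>x. p (F i x))" for i
      by (rule simple_function_compose1[OF F(1)])
    show "norm (p (F i x)) \<le> 1" for i x
      by (auto simp: p_def divide_simps max_def)
    fix x assume x: "x \<in> space M"
    have "(\<lambda>i. p (F i x)) \<longlonglongrightarrow> f x /\<^sub>R max 1 (norm (f x))"
      unfolding p_def by (intro tendsto_intros F(2) x) auto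
    also have "f x /\<^sub>R max 1 (norm (f x)) = f x"
      using f[OF x] by (simp add: max_def)
    finally show "(\<lambda>i. p (F i x)) \<longlonglongrightarrow> f x" .
  qed
qed

locale integrable_kernel = sigma_finite_measure M for M :: "'a measure" +
  fixes K :: "'a \<Rightarrow> 'a \<Rightarrow> real"
  assumes integrable_kernel: "integrable (M \<Otimes>\<^sub>M M) (\<lambda>p. K (fst p) (snd p))"
begin

sublocale pair_sigma_finite M M ..

lemma measurable_kernel [measurable]: "(\<lambda>p. K (fst p) (snd p)) \<in> borel_measurable (M \<Otimes>\<^sub>M M)"
  using integrable_kernel by auto

lemma integrable_kernel_times:
  fixes \<phi> :: "'a \<times> 'a \<Rightarrow> 'b::{banach, second_countable_topology}"
  assumes [measurable]: "\<phi> \<in> borel_measurable (M \<Otimes>\<^sub>M M)"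
    and "\<And>p. p \<in> space (M \<Otimes>\<^sub>M M) \<Longrightarrow> norm (\<phi> p) \<le> 1"
  shows "integrable (M \<Otimes>\<^sub>M M) (\<lambda>p. K (fst p) (snd p) *\<^sub>R \<phi> p)"
proof (rule Bochner_Integration.integrable_bound[OF integrable_kernel])
  show "AE p in M \<Otimes>\<^sub>M M. norm (K (fst p) (snd p) *\<^sub>R \<phi> p) \<le> norm (K (fst p) (snd p))"
    using assms(2) by (intro AE_I2) (simp add: mult_left_le)
qed simp

context
  fixes f :: "'a \<Rightarrow> 'h::{real_inner, banach, second_countable_topology}"
  assumes f_measurable [measurable]: "f \<in> borel_measurable M"
    and f_bound: "\<And>z. z \<in> space M \<Longrightarrow> norm (f z) \<le> 1"
begin

lemma integrable_kernel_snd: "integrable (M \<Otimes>\<^sub>M M) (\<lambda>p. K (fst p) (snd p) *\<^sub>R f (snd p))"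
  by (rule integrable_kernel_times) (auto simp: space_pair_measure intro: f_bound)

lemma integrable_kernel_operator: "integrable M (kernel_operator M K f)"
  using integrable_fst'[OF integrable_kernel_snd] by (simp add: kernel_operator_def[abs_def])

lemma integral_kernel_operator_pairing:
  assumes [measurable]: "g \<in> borel_measurable M"
    and g: "\<And>z. z \<in> space M \<Longrightarrow> norm (g z) \<le> 1"
  shows "(\<integral>z. kernel_operator M K f z \<bullet> g z \<partial>M)
    = (\<integral>p. K (fst p) (snd p) * (f (snd p) \<bullet> g (fst p)) \<partial>(M \<Otimes>\<^sub>M M))"
proof -
  have "integrable (M \<Otimes>\<^sub>M M) (\<lambda>p. K (fst p) (snd p) *\<^sub>R (f (snd p) \<bullet> g (fst p)))"
  proof (rule integrable_kernel_times)
    fix p assume "p \<in> space (M \<Otimes>\<^sub>M M)"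
    then have "norm (f (snd p)) * norm (g (fst p)) \<le> 1"
      by (intro mult_le_one f_bound g) (auto simp: space_pair_measure)
    then show "norm (f (snd p) \<bullet> g (fst p)) \<le> 1"
      using Cauchy_Schwarz_ineq2 order.trans by fastforce
  qed simp
  then have int: "integrable (M \<Otimes>\<^sub>M M) (\<lambda>p. K (fst p) (snd p) * (f (snd p) \<bullet> g (fst p)))"
    by simp
  have "(\<integral>p. K (fst p) (snd p) * (f (snd p) \<bullet> g (fst p)) \<partial>(M \<Otimes>\<^sub>M M))
      = (\<integral>z. \<integral>z'. K z z' * (f z' \<bullet> g z) \<partial>M \<partial>M)"
    using integral_fst'[OF int] by simp
  also have "\<dots> = (\<integral>z. kernel_operator M K f z \<bullet> g z \<partial>M)"
  proof (rule integral_cong_AE)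
    show "(\<lambda>z. \<integral>z'. K z z' * (f z' \<bullet> g z) \<partial>M) \<in> borel_measurable M"
      using integrable_fst'[OF int] by auto
    show "(\<lambda>z. kernel_operator M K f z \<bullet> g z) \<in> borel_measurable M"
      using integrable_kernel_operator by (intro borel_measurable_inner) auto
    show "AE z in M. (\<integral>z'. K z z' * (f z' \<bullet> g z) \<partial>M) = kernel_operator M K f z \<bullet> g z"
      using AE_integrable_fst'[OF integrable_kernel_snd]
    proof eventually_elim
      case (elim z)
      then have "(\<integral>z'. (K z z' *\<^sub>R f z') \<bullet> g z \<partial>M) = kernel_operator M K f z \<bullet> g z"
        unfolding kernel_operator_def by (intro integral_inner_left) simp
      then show ?case
        by simp
    qed
  qed
  finally show ?thesis
    by simp
qed

lemma integral_norm_kernel_operator: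
  "(\<integral>z. norm (kernel_operator M K f z) \<partial>M)
    = (\<integral>p. K (fst p) (snd p) * (f (snd p) \<bullet> sgn (kernel_operator M K f (fst p))) \<partial>(M \<Otimes>\<^sub>M M))"
proof -
  have [measurable]: "kernel_operator M K f \<in> borel_measurable M"
    using integrable_kernel_operator by auto
  have "x \<bullet> sgn x = norm x" for x :: 'h
    by (cases "x = 0") (simp_all add: sgn_div_norm dot_square_norm power2_eq_square)
  then have "(\<integral>z. norm (kernel_operator M K f z) \<partial>M)
      = (\<integral>z. kernel_operator M K f z \<bullet> sgn (kernel_operator M K f z) \<partial>M)"
    by simp
  also have "\<dots> = (\<integral>p. K (fst p) (snd p) * (f (snd p) \<bullet> sgn (kernel_operator M K f (fst p))) \<partial>(M \<Otimes>\<^sub>M M))"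
  proof (rule integral_kernel_operator_pairing)
    show "(\<lambda>z. sgn (kernel_operator M K f z)) \<in> borel_measurable M"
      unfolding sgn_div_norm by simp
  qed (simp add: norm_sgn)
  finally show ?thesis .
qed

lemma L1_norm_kernel_operator:
  "L1_norm M (kernel_operator M K f) = ennreal (\<integral>z. norm (kernel_operator M K f z) \<partial>M)"
  unfolding L1_norm_def
  by (intro nn_integral_eq_integral integrable_norm integrable_kernel_operator) auto

lemma L1_norm_kernel_operator_le:
  "L1_norm M (kernel_operator M K f) \<le> ennreal (\<integral>p. \<bar>K (fst p) (snd p)\<bar> \<partial>(M \<Otimes>\<^sub>M M))"
proof -
  have [measurable]: "kernel_operator M K f \<in> borel_measurable M"
    using integrable_kernel_operator by auto
  have "(\<integral>z. norm (kernel_operator M K f z) \<partial>M) \<le> (\<integral>p. \<bar>K (fst p) (snd p)\<bar> \<partial>(M \<Otimes>\<^sub>M M))"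
    unfolding integral_norm_kernel_operator
  proof (rule integral_mono')
    show "integrable (M \<Otimes>\<^sub>M M) (\<lambda>p. \<bar>K (fst p) (snd p)\<bar>)"
      using integrable_kernel by auto
    fix p assume "p \<in> space (M \<Otimes>\<^sub>M M)"
    then have "norm (f (snd p)) * norm (sgn (kernel_operator M K f (fst p))) \<le> 1"
      by (intro mult_le_one f_bound) (auto simp: space_pair_measure norm_sgn)
    then have "\<bar>f (snd p) \<bullet> sgn (kernel_operator M K f (fst p))\<bar> \<le> 1"
      using Cauchy_Schwarz_ineq2 order.trans by blast
    then have "\<bar>K (fst p) (snd p) * (f (snd p) \<bullet> sgn (kernel_operator M K f (fst p)))\<bar>
        \<le> \<bar>K (fst p) (snd p)\<bar>"
      by (simp add: abs_mult mult_left_le)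
    then show "K (fst p) (snd p) * (f (snd p) \<bullet> sgn (kernel_operator M K f (fst p)))
        \<le> \<bar>K (fst p) (snd p)\<bar>"
      by linarith
  qed simp
  then show ?thesis
    by (simp add: L1_norm_kernel_operator ennreal_leI)
qed

end

lemma Linf_L1_opnorm_kernel_operator_finite:
  "Linf_L1_opnorm M (kernel_operator M K :: ('a \<Rightarrow> real) \<Rightarrow> _) < top"
proof -
  have "Linf_L1_opnorm M (kernel_operator M K :: ('a \<Rightarrow> real) \<Rightarrow> _)
      \<le> ennreal (\<integral>p. \<bar>K (fst p) (snd p)\<bar> \<partial>(M \<Otimes>\<^sub>M M))"
    unfolding Linf_L1_opnorm_def Linf_norm_le_1_iff
    by (intro SUP_least L1_norm_kernel_operator_le) auto
  then show ?thesis
    using ennreal_less_top order.strict_trans1 by blast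
qed

text \<open>
  The integral of the kernel over the rectangle of cells \<open>{h = x} \<times> {h = y}\<close>, so that the row index
  \<open>x\<close> belongs to the output variable of the operator and the column index \<open>y\<close> to its input variable.
\<close>

definition cell_matrix :: "('a \<Rightarrow> 'b) \<Rightarrow> 'b \<Rightarrow> 'b \<Rightarrow> real" where
  "cell_matrix h x y = (\<integral>p. K (fst p) (snd p) *
     (indicator (h -` {x} \<inter> space M) (fst p) * indicator (h -` {y} \<inter> space M) (snd p)) \<partial>(M \<Otimes>\<^sub>M M))"

lemma integral_simple_pairing:
  assumes h: "simple_function M h"
  shows "(\<integral>p. K (fst p) (snd p) * \<phi> (h (snd p)) (h (fst p)) \<partial>(M \<Otimes>\<^sub>M M))
    = (\<Sum>x\<in>h ` space M. \<Sum>y\<in>h ` space M. cell_matrix h x y * \<phi> y x)"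
proof -
  let ?R = "h ` space M"
  let ?I = "\<lambda>x y p. indicator (h -` {x} \<inter> space M) (fst p) * indicator (h -` {y} \<inter> space M) (snd p) :: real"
  have fin: "finite ?R"
    using h by (rule simple_functionD)
  have [measurable]: "h -` {x} \<inter> space M \<in> sets M" for x
    using h by (rule simple_functionD)
  have "integrable (M \<Otimes>\<^sub>M M) (\<lambda>p. K (fst p) (snd p) *\<^sub>R ?I x y p)" for x y
    by (rule integrable_kernel_times, measurable) (simp add: indicator_def)
  then have int: "integrable (M \<Otimes>\<^sub>M M) (\<lambda>p. K (fst p) (snd p) * ?I x y p)" for x y
    by simp
  have "(\<integral>p. K (fst p) (snd p) * \<phi> (h (snd p)) (h (fst p)) \<partial>(M \<Otimes>\<^sub>M M))
      = (\<integral>p. (\<Sum>x\<in>?R. \<Sum>y\<in>?R. K (fst p) (snd p) * ?I x y p * \<phi> y x) \<partial>(M \<Otimes>\<^sub>M M))"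
  proof (rule Bochner_Integration.integral_cong[OF refl])
    fix p assume "p \<in> space (M \<Otimes>\<^sub>M M)"
    then have p: "fst p \<in> space M" "snd p \<in> space M"
      by (auto simp: space_pair_measure)
    have "(\<Sum>x\<in>?R. \<Sum>y\<in>?R. K (fst p) (snd p) * ?I x y p * \<phi> y x)
        = (\<Sum>x\<in>?R. \<Sum>y\<in>?R. if h (snd p) = y then
             if h (fst p) = x then K (fst p) (snd p) * \<phi> (h (snd p)) (h (fst p)) else 0 else 0)"
      using p by (intro sum.cong refl) (auto simp: indicator_def)
    also have "\<dots> = K (fst p) (snd p) * \<phi> (h (snd p)) (h (fst p))"
      using p fin by (simp add: sum.delta')
    finally show "K (fst p) (snd p) * \<phi> (h (snd p)) (h (fst p))
        = (\<Sum>x\<in>?R. \<Sum>y\<in>?R. K (fst p) (snd p) * ?I x y p * \<phi> y x)"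
      by simp
  qed
  also have "\<dots> = (\<Sum>x\<in>?R. \<Sum>y\<in>?R. cell_matrix h x y * \<phi> y x)"
    using int unfolding cell_matrix_def by simp
  finally show ?thesis .
qed

lemma cell_matrix_bilinear_form_le:
  fixes s t :: "'b \<Rightarrow> real"
  assumes h: "simple_function M h"
    and s: "\<And>x. x \<in> h ` space M \<Longrightarrow> \<bar>s x\<bar> \<le> 1" and t: "\<And>x. x \<in> h ` space M \<Longrightarrow> \<bar>t x\<bar> \<le> 1"
  shows "\<bar>\<Sum>x\<in>h ` space M. \<Sum>y\<in>h ` space M. cell_matrix h x y * (s y * t x)\<bar>
    \<le> enn2real (Linf_L1_opnorm M (kernel_operator M K :: ('a \<Rightarrow> real) \<Rightarrow> _))"
proof -
  let ?T = "kernel_operator M K (\<lambda>z. s (h z))"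
  have [measurable]: "(\<lambda>z. s (h z)) \<in> borel_measurable M" "(\<lambda>z. t (h z)) \<in> borel_measurable M"
    using simple_function_compose1[OF h] by (auto intro: borel_measurable_simple_function)
  have s': "\<bar>s (h z)\<bar> \<le> 1" and t': "\<bar>t (h z)\<bar> \<le> 1" if "z \<in> space M" for z
    using s t that by auto
  have T: "integrable M ?T"
    by (rule integrable_kernel_operator) (auto simp: s')
  have "(\<Sum>x\<in>h ` space M. \<Sum>y\<in>h ` space M. cell_matrix h x y * (s y * t x))
      = (\<integral>z. ?T z \<bullet> t (h z) \<partial>M)"
    using integral_kernel_operator_pairing[of "\<lambda>z. s (h z)" "\<lambda>z. t (h z)"]
      integral_simple_pairing[OF h, of "\<lambda>y x. s y * t x"] s' t' by simp
  also have "\<bar>\<dots>\<bar> \<le> (\<integral>z. norm (?T z) \<partial>M)"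
  proof (rule order.trans[OF integral_abs_bound], rule integral_mono')
    show "integrable M (\<lambda>z. norm (?T z))"
      using T by (rule integrable_norm)
    show "\<bar>?T z \<bullet> t (h z)\<bar> \<le> norm (?T z)" if "z \<in> space M" for z
      using t'[OF that] by (simp add: abs_mult mult_left_le)
  qed simp
  finally have "ennreal \<bar>\<Sum>x\<in>h ` space M. \<Sum>y\<in>h ` space M. cell_matrix h x y * (s y * t x)\<bar>
      \<le> L1_norm M ?T"
    using L1_norm_kernel_operator[of "\<lambda>z. s (h z)"] s' by (simp add: ennreal_leI)
  also have "\<dots> \<le> Linf_L1_opnorm M (kernel_operator M K :: ('a \<Rightarrow> real) \<Rightarrow> _)"
    unfolding Linf_L1_opnorm_def Linf_norm_le_1_iff by (rule SUP_upper) (auto simp: s')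
  finally have "enn2real (ennreal \<bar>\<Sum>x\<in>h ` space M. \<Sum>y\<in>h ` space M. cell_matrix h x y * (s y * t x)\<bar>)
      \<le> enn2real (Linf_L1_opnorm M (kernel_operator M K :: ('a \<Rightarrow> real) \<Rightarrow> _))"
    by (rule enn2real_mono[OF _ Linf_L1_opnorm_kernel_operator_finite])
  then show ?thesis
    by simp
qed

text \<open>
  A common bound for the bilinear forms of all cell matrices at vectors in the unit ball is a bound
  for the operator norm.
  Taking the pair \<open>(F i, G i)\<close> of approximants as the simple function gives one partition that
  serves both arguments.
\<close>

lemma Linf_L1_opnorm_le_of_cell_matrix:
  fixes D :: real
  assumes D: "\<And>(h :: 'a \<Rightarrow> 'h \<times> 'h) (u :: 'h \<times> 'h \<Rightarrow> 'h) v. simple_function M h \<Longrightarrow>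
      (\<And>x. x \<in> h ` space M \<Longrightarrow> norm (u x) \<le> 1) \<Longrightarrow> (\<And>x. x \<in> h ` space M \<Longrightarrow> norm (v x) \<le> 1) \<Longrightarrow>
      (\<Sum>x\<in>h ` space M. \<Sum>y\<in>h ` space M. cell_matrix h x y * (u y \<bullet> v x)) \<le> D"
  shows "Linf_L1_opnorm M
    (kernel_operator M K :: ('a \<Rightarrow> 'h::{real_inner, banach, second_countable_topology}) \<Rightarrow> 'a \<Rightarrow> 'h)
    \<le> ennreal D"
  unfolding Linf_L1_opnorm_def Linf_norm_le_1_iff
proof (rule SUP_least, clarify)
  fix f :: "'a \<Rightarrow> 'h"
  assume fm [measurable]: "f \<in> borel_measurable M" and f: "\<forall>z\<in>space M. norm (f z) \<le> 1"
  define g where "g z = sgn (kernel_operator M K f z)" for z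
  have [measurable]: "kernel_operator M K f \<in> borel_measurable M"
    using integrable_kernel_operator[of f] f by auto
  have gm [measurable]: "g \<in> borel_measurable M"
    unfolding g_def[abs_def] sgn_div_norm by simp
  have g: "norm (g z) \<le> 1" for z
    by (simp add: g_def norm_sgn)
  obtain F where F: "\<And>i. simple_function M (F i)" "\<And>i x. norm (F i x) \<le> 1"
    "\<And>x. x \<in> space M \<Longrightarrow> (\<lambda>i. F i x) \<longlonglongrightarrow> f x"
    using simple_approximation_unit_ball[OF fm] f by blast
  obtain G where G: "\<And>i. simple_function M (G i)" "\<And>i x. norm (G i x) \<le> 1"
    "\<And>x. x \<in> space M \<Longrightarrow> (\<lambda>i. G i x) \<longlonglongrightarrow> g x"
    using simple_approximation_unit_ball[OF gm g] by blast
  note [measurable] = borel_measurable_simple_function[OF F(1)] borel_measurable_simple_function[OF G(1)]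
  let ?B = "\<lambda>i. \<integral>p. K (fst p) (snd p) * (F i (snd p) \<bullet> G i (fst p)) \<partial>(M \<Otimes>\<^sub>M M)"
  have "?B i \<le> D" for i
  proof -
    let ?h = "\<lambda>z. (F i z, G i z)"
    have h: "simple_function M ?h"
      using F(1) G(1) by simp
    have "?B i = (\<Sum>x\<in>?h ` space M. \<Sum>y\<in>?h ` space M. cell_matrix ?h x y * (fst y \<bullet> snd x))"
      using integral_simple_pairing[OF h, of "\<lambda>y x. fst y \<bullet> snd x"] by simp
    also have "\<dots> \<le> D"
      by (rule D[OF h, of fst snd]) (use F(2) G(2) in auto)
    finally show ?thesis .
  qed
  moreover have "?B \<longlonglongrightarrow> (\<integral>p. K (fst p) (snd p) * (f (snd p) \<bullet> g (fst p)) \<partial>(M \<Otimes>\<^sub>M M))"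
  proof (rule integral_dominated_convergence[where w = "\<lambda>p. \<bar>K (fst p) (snd p)\<bar>"])
    show "integrable (M \<Otimes>\<^sub>M M) (\<lambda>p. \<bar>K (fst p) (snd p)\<bar>)"
      using integrable_kernel by auto
    show "AE p in M \<Otimes>\<^sub>M M. (\<lambda>i. K (fst p) (snd p) * (F i (snd p) \<bullet> G i (fst p)))
        \<longlonglongrightarrow> K (fst p) (snd p) * (f (snd p) \<bullet> g (fst p))"
      by (intro AE_I2 tendsto_intros F(3) G(3)) (auto simp: space_pair_measure)
    have "\<bar>F i x \<bullet> G i y\<bar> \<le> 1" for i x y
      using Cauchy_Schwarz_ineq2[of "F i x" "G i y"] mult_le_one[OF F(2) norm_ge_zero G(2), of i x i y]
      by linarith
    then show "AE p in M \<Otimes>\<^sub>M M. norm (K (fst p) (snd p) * (F i (snd p) \<bullet> G i (fst p)))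
        \<le> \<bar>K (fst p) (snd p)\<bar>" for i
      by (simp add: abs_mult mult_left_le)
  qed simp_all
  ultimately have "(\<integral>p. K (fst p) (snd p) * (f (snd p) \<bullet> g (fst p)) \<partial>(M \<Otimes>\<^sub>M M)) \<le> D"
    by (intro LIMSEQ_le_const2) auto
  then show "L1_norm M (kernel_operator M K f) \<le> ennreal D"
    using L1_norm_kernel_operator[of f] integral_norm_kernel_operator[of f] f
    by (simp add: g_def ennreal_leI)
qed

theorem Linf_L1_opnorm_vector_valued_le:
  "Linf_L1_opnorm M
     (kernel_operator M K :: ('a \<Rightarrow> 'h::{real_inner, banach, second_countable_topology}) \<Rightarrow> 'a \<Rightarrow> 'h)
   \<le> grothendieck_constant * Linf_L1_opnorm M (kernel_operator M K :: ('a \<Rightarrow> real) \<Rightarrow> 'a \<Rightarrow> real)"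
  (is "?L \<le> _ * ?B")
proof (cases "?B = 0")
  case True
  have "?L \<le> ennreal 0"
  proof (rule Linf_L1_opnorm_le_of_cell_matrix)
    fix h :: "'a \<Rightarrow> 'h \<times> 'h" and u v :: "'h \<times> 'h \<Rightarrow> 'h"
    assume h: "simple_function M h"
    have "cell_matrix h x y = 0" if "x \<in> h ` space M" "y \<in> h ` space M" for x y
      using zero_bilinear_form_finite_set[OF simple_functionD(1)[OF h], of "cell_matrix h"]
        cell_matrix_bilinear_form_le[OF h] True that by simp
    then show "(\<Sum>x\<in>h ` space M. \<Sum>y\<in>h ` space M. cell_matrix h x y * (u y \<bullet> v x)) \<le> 0"
      by simp
  qed
  then show ?thesis
    by simp
next
  case False
  have B: "?B < top"
    by (rule Linf_L1_opnorm_kernel_operator_finite)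
  have "?L / ?B \<le> grothendieck_constant"
    unfolding grothendieck_constant_def
  proof (rule INF_greatest, clarify)
    fix C assume C: "grothendieck_bound C"
    have "?L \<le> ennreal (C * enn2real ?B)"
    proof (rule Linf_L1_opnorm_le_of_cell_matrix)
      fix h :: "'a \<Rightarrow> 'h \<times> 'h" and u v :: "'h \<times> 'h \<Rightarrow> 'h"
      assume h: "simple_function M h"
        and uv: "\<And>x. x \<in> h ` space M \<Longrightarrow> norm (u x) \<le> 1" "\<And>x. x \<in> h ` space M \<Longrightarrow> norm (v x) \<le> 1"
      have "\<bar>\<Sum>x\<in>h ` space M. \<Sum>y\<in>h ` space M. cell_matrix h x y * (u y \<bullet> v x)\<bar> \<le> C * enn2real ?B"
        using uv by (intro grothendieck_bound_finite_set[OF C simple_functionD(1)[OF h]]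
            cell_matrix_bilinear_form_le[OF h]) blast+
      then show "(\<Sum>x\<in>h ` space M. \<Sum>y\<in>h ` space M. cell_matrix h x y * (u y \<bullet> v x)) \<le> C * enn2real ?B"
        by linarith
    qed
    also have "\<dots> = ?B * ennreal C"
      using B grothendieck_bound_nonneg[OF C] by (simp add: ennreal_mult mult.commute)
    finally show "?L / ?B \<le> ennreal C"
      using False by (intro divide_le_posI_ennreal) (simp_all add: zero_less_iff_neq_zero)
  qed
  then have "?L / ?B * ?B \<le> grothendieck_constant * ?B"
    by (rule mult_right_mono) simp
  then show ?thesis
    using False B by (simp add: ennreal_divide_times ennreal_mult_divide_eq mult_divide_eq_ennreal)
qed

end

section \<open>Integrability of the ensembling kernel\<close>

text \<open>
  By Tonelli, the integral of \<open>|K|\<close> is at most the expectation of the square of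
  \<open>\<integral> |q w z0 - q w z1| \<partial>\<mu>(w)\<close>, and this integral is at most 2.
\<close>

lemma integrable_ensembling_kernel:
  fixes \<mu> :: "'a measure" and P :: "('a \<times> 'a) measure"
  assumes "sigma_finite_measure \<mu>" and "prob_space P" and sets_P: "sets P = sets (\<mu> \<Otimes>\<^sub>M \<mu>)"
    and q_measurable: "(\<lambda>(w, z). q w z) \<in> borel_measurable (\<mu> \<Otimes>\<^sub>M \<mu>)"
    and q_nonneg: "\<And>w z. w \<in> space \<mu> \<Longrightarrow> z \<in> space \<mu> \<Longrightarrow> 0 \<le> q w z"
    and q_mass: "\<And>z. z \<in> space \<mu> \<Longrightarrow> (\<integral>\<^sup>+w. ennreal (q w z) \<partial>\<mu>) = 1"
  shows "integrable (\<mu> \<Otimes>\<^sub>M \<mu>) (\<lambda>p. ensembling_kernel P q (fst p) (snd p))"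
proof -
  interpret \<mu>: sigma_finite_measure \<mu> by fact
  interpret P: prob_space P by fact
  interpret \<mu>\<mu>: pair_sigma_finite \<mu> \<mu> ..
  interpret sigma_finite_measure "\<mu> \<Otimes>\<^sub>M \<mu>"
    by (rule sigma_finite_pair_measure) fact+
  interpret PP: pair_sigma_finite "\<mu> \<Otimes>\<^sub>M \<mu>" P ..
  note [measurable_cong] = sets_P
  have space_P: "space P = space \<mu> \<times> space \<mu>"
    using sets_eq_imp_space_eq[OF sets_P] by (simp add: space_pair_measure)
  have q_comp [measurable]: "(\<lambda>x. q (f x) (g x)) \<in> borel_measurable N"
    if "f \<in> N \<rightarrow>\<^sub>M \<mu>" "g \<in> N \<rightarrow>\<^sub>M \<mu>" for f g and N :: "'c measure"
    using measurable_compose[OF measurable_Pair[OF that] q_measurable] by simp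
  let ?d = "\<lambda>w c. q w (fst c) - q w (snd c)"
  let ?F = "\<lambda>x. ?d (fst (fst x)) (snd x) * ?d (snd (fst x)) (snd x)"
  have d: "(\<integral>\<^sup>+w. ennreal \<bar>?d w c\<bar> \<partial>\<mu>) \<le> 2" if "c \<in> space P" for c
  proof -
    have c: "fst c \<in> space \<mu>" "snd c \<in> space \<mu>"
      using that by (auto simp: space_P)
    have "(\<integral>\<^sup>+w. ennreal \<bar>?d w c\<bar> \<partial>\<mu>) \<le> (\<integral>\<^sup>+w. ennreal (q w (fst c)) + ennreal (q w (snd c)) \<partial>\<mu>)"
      using q_nonneg c
      by (intro nn_integral_mono) (auto simp: ennreal_plus[symmetric] abs_le_iff intro!: ennreal_leI simp del: ennreal_plus)
    also have "\<dots> = 1 + 1"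
      using c by (subst nn_integral_add) (auto simp: q_mass)
    finally show ?thesis
      by simp
  qed
  have "integrable ((\<mu> \<Otimes>\<^sub>M \<mu>) \<Otimes>\<^sub>M P) ?F"
  proof (rule integrableI_bounded)
    show "?F \<in> borel_measurable ((\<mu> \<Otimes>\<^sub>M \<mu>) \<Otimes>\<^sub>M P)"
      by measurable
    have "(\<integral>\<^sup>+x. ennreal (norm (?F x)) \<partial>((\<mu> \<Otimes>\<^sub>M \<mu>) \<Otimes>\<^sub>M P))
        = (\<integral>\<^sup>+c. \<integral>\<^sup>+p. ennreal (norm (?F (p, c))) \<partial>(\<mu> \<Otimes>\<^sub>M \<mu>) \<partial>P)"
      by (rule PP.nn_integral_snd[symmetric]) measurable
    also have "\<dots> \<le> (\<integral>\<^sup>+c. 4 \<partial>P)"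
    proof (rule nn_integral_mono)
      fix c assume c: "c \<in> space P"
      then have [measurable]: "fst c \<in> space \<mu>" "snd c \<in> space \<mu>"
        by (auto simp: space_P)
      have "(\<integral>\<^sup>+p. ennreal (norm (?F (p, c))) \<partial>(\<mu> \<Otimes>\<^sub>M \<mu>))
          = (\<integral>\<^sup>+w. \<integral>\<^sup>+w'. ennreal \<bar>?d w c\<bar> * ennreal \<bar>?d w' c\<bar> \<partial>\<mu> \<partial>\<mu>)"
        by (subst \<mu>.nn_integral_fst[symmetric]) (auto simp: abs_mult ennreal_mult)
      also have "\<dots> = (\<integral>\<^sup>+w. ennreal \<bar>?d w c\<bar> \<partial>\<mu>) * (\<integral>\<^sup>+w. ennreal \<bar>?d w c\<bar> \<partial>\<mu>)"
        by (simp add: nn_integral_cmult nn_integral_multc)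
      also have "\<dots> \<le> 2 * 2"
        by (intro mult_mono d c) auto
      finally show "(\<integral>\<^sup>+p. ennreal (norm (?F (p, c))) \<partial>(\<mu> \<Otimes>\<^sub>M \<mu>)) \<le> 4"
        by simp
    qed
    also have "\<dots> < \<infinity>"
      by (simp add: P.emeasure_space_1)
    finally show "(\<integral>\<^sup>+x. ennreal (norm (?F x)) \<partial>((\<mu> \<Otimes>\<^sub>M \<mu>) \<Otimes>\<^sub>M P)) < \<infinity>" .
  qed
  from PP.integrable_fst'[OF this] show ?thesis
    by (simp add: ensembling_kernel_def case_prod_unfold)
qed

lemma ensembling_operator_eq_kernel_operator:
  "ensembling_operator \<mu> P q = kernel_operator \<mu> (ensembling_kernel P q)"
  by (simp add: fun_eq_iff ensembling_operator_def kernel_operator_def)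

theorem proposition13:
  fixes \<mu> :: "'a measure"
    and P :: "('a \<times> 'a) measure"
    and Q :: "'a \<Rightarrow> 'a measure"
    and q :: "'a \<Rightarrow> 'a \<Rightarrow> real"
  assumes "sigma_finite_measure \<mu>"
    and "prob_space P" and "sets P = sets (\<mu> \<Otimes>\<^sub>M \<mu>)"
    and "Q \<in> \<mu> \<rightarrow>\<^sub>M prob_algebra \<mu>"
    and "(\<lambda>(w, z). q w z) \<in> borel_measurable (\<mu> \<Otimes>\<^sub>M \<mu>)"
    and "\<And>w z. w \<in> space \<mu> \<Longrightarrow> z \<in> space \<mu> \<Longrightarrow> 0 \<le> q w z"
    and "\<And>z. z \<in> space \<mu> \<Longrightarrow> Q z = density \<mu> (\<lambda>w. ennreal (q w z))"
  shows "Linf_L1_opnorm \<mu> (ensembling_operator \<mu> P q ::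
           ('a \<Rightarrow> 'h::{real_inner, banach, second_countable_topology}) \<Rightarrow> 'a \<Rightarrow> 'h)
         \<le> grothendieck_constant *
           Linf_L1_opnorm \<mu> (ensembling_operator \<mu> P q :: ('a \<Rightarrow> real) \<Rightarrow> 'a \<Rightarrow> real)"
proof -
  have q_mass: "(\<integral>\<^sup>+w. ennreal (q w z) \<partial>\<mu>) = 1" if z: "z \<in> space \<mu>" for z
  proof -
    have [measurable]: "(\<lambda>w. q w z) \<in> borel_measurable \<mu>"
      using measurable_compose[OF measurable_Pair2'[OF z] assms(5)] by simp
    have "prob_space (Q z)"
      using measurable_space[OF assms(4) z] by (simp add: space_prob_algebra)
    then have "emeasure (density \<mu> (\<lambda>w. ennreal (q w z))) (space \<mu>) = 1"
      using prob_space.emeasure_space_1 assms(7)[OF z] by fastforce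
    then show ?thesis
      by (simp add: emeasure_density cong: nn_integral_cong)
  qed
  interpret sigma_finite_measure \<mu> by fact
  interpret integrable_kernel \<mu> "ensembling_kernel P q"
    by unfold_locales (rule integrable_ensembling_kernel[OF assms(1-3,5,6) q_mass])
  show ?thesis
    unfolding ensembling_operator_eq_kernel_operator by (rule Linf_L1_opnorm_vector_valued_le)
qed

end
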